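(* Let $p$ be an odd prime with $p \equiv 3 \pmod 8$ and let $k$ be a positive integer. Then there are no positive integers $A,B,C,D$ with $\gcd(A,B,C) = p^k$ satisfying $A + B = C$ and $ABC = D^4$. *)

theory Defs
  imports "HOL-Number_Theory.Number_Theory"
begin

end

theory Submission
  imports Defs "HOL-Computational_Algebra.Nth_Powers"
begin

text \<open>
  Dividing out \<open>p ^ k\<close> leaves coprime \<open>a + b = c\<close> such that \<open>c\<close> and one of \<open>a\<close>, \<open>b\<close> are fourth
  powers, while the remaining number is a square or \<open>p\<close> times a square. This gives
  \<open>z\<^sup>4 - x\<^sup>4 = q w\<^sup>2\<close> with \<open>q = 1\<close> or \<open>q = p\<close>, hence a primitive Pythagorean triangle whose area is
  \<open>q\<close> times a square. Fermat's descent excludes such triangles: for \<open>p \<equiv> 3\<close> modulo 8, all but one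
  distribution of the factor \<open>q\<close> over the four factors of the area are impossible, and the
  remaining one leads to a smaller triangle.
\<close>

section \<open>Primes dividing a sum of two squares, and coprime factors of squares\<close>

lemma coprime_summand_nat:
  fixes a b :: nat
  shows "coprime a (a + b) \<longleftrightarrow> coprime a b" "coprime b (a + b) \<longleftrightarrow> coprime a b"
  by (simp_all only: coprime_iff_gcd_eq_1 gcd_add1 gcd_add2 gcd.commute[of b "a + b"])

text \<open>Here \<open>h = (p - 1) / 2\<close> is odd. If \<open>p\<close> divided neither
  \<open>a\<close> nor \<open>b\<close>, then raising \<open>a\<^sup>2 \<equiv> - b\<^sup>2\<close>
  to the power \<open>h\<close> would make \<open>a ^ (p - 1) + b ^ (p - 1)\<close> congruent to 0,
  while Fermat's little theorem makes it 2.\<close>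

lemma prime_3_mod_4_dvd_sum_squares:
  fixes p a b :: nat
  assumes p: "prime p" "p mod 4 = 3" and dvd: "p dvd a\<^sup>2 + b\<^sup>2"
  shows "p dvd a"
proof (rule ccontr)
  assume na: "\<not> p dvd a"
  have nb: "\<not> p dvd b"
  proof
    assume "p dvd b"
    hence "p dvd b\<^sup>2" by (simp add: power2_eq_square)
    with dvd have "p dvd a\<^sup>2" by (simp add: dvd_add_left_iff)
    with na p(1) show False using prime_dvd_power by blast
  qed
  obtain j where j: "p = 4 * j + 3"
    using p(2) by (metis mult.commute div_mult_mod_eq)
  define h where "h = 2 * j + 1"
  have h: "p - 1 = 2 * h" "odd h" using j by (auto simp: h_def)
  have "[a ^ (2 * h) = 1] (mod p)" "[b ^ (2 * h) = 1] (mod p)"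
    using fermat_theorem[OF p(1) na] fermat_theorem[OF p(1) nb] h by auto
  hence "[a ^ (2 * h) + b ^ (2 * h) = 1 + 1] (mod p)"
    by (rule cong_add)
  hence c: "[(a\<^sup>2) ^ h + (b\<^sup>2) ^ h = 2] (mod p)"
    unfolding power_mult one_add_one .
  have "[int a ^ 2 = - (int b ^ 2)] (mod int p)"
    using dvd by (simp add: cong_iff_dvd_diff flip: of_nat_power of_nat_add)
  hence "[(int a ^ 2) ^ h = (- (int b ^ 2)) ^ h] (mod int p)"
    by (rule cong_pow)
  hence "int p dvd (int a ^ 2) ^ h + (int b ^ 2) ^ h"
    using h(2) by (simp add: cong_iff_dvd_diff)
  hence "p dvd (a\<^sup>2) ^ h + (b\<^sup>2) ^ h"
    by (simp flip: of_nat_power of_nat_add)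
  with c have "p dvd 2" using cong_dvd_iff by blast
  thus False using j by (auto dest: dvd_imp_le)
qed

lemma coprime_mult_squareD:
  fixes u v s :: nat
  assumes "coprime u v" "u * v = s\<^sup>2" "u > 0" "v > 0"
  obtains a b where "u = a\<^sup>2" "v = b\<^sup>2"
proof -
  have "is_nth_power 2 (u * v)" using assms(2) by auto
  hence "is_nth_power 2 u" "is_nth_power 2 v"
    using is_nth_power_mult_coprime_natD[of u v 2] assms by (auto simp: coprime_commute)
  thus ?thesis using that by (auto elim!: is_nth_powerE)
qed

text \<open>A prime \<open>q\<close> divides one of the factors, and cancelling it there leaves
  coprime numbers whose product is a square. Admitting \<open>q = 1\<close> lets the descent treat
  both values of \<open>q\<close> at once.\<close>

lemma coprime_mult_prime_squareD:
  fixes u v s q :: nat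
  assumes "coprime u v" "u * v = q * s\<^sup>2" "u > 0" "v > 0" and q: "q = 1 \<or> prime q"
  obtains a b where "u = q * a\<^sup>2" "v = b\<^sup>2" | a b where "u = a\<^sup>2" "v = q * b\<^sup>2"
proof (cases "q = 1")
  case True
  thus ?thesis using coprime_mult_squareD[of u v s] assms that by auto
next
  case False
  hence q: "prime q" using q by simp
  hence q0: "q > 0" by (simp add: prime_gt_0_nat)
  have "q dvd u * v" using assms(2) by simp
  then consider "q dvd u" | "q dvd v" using q prime_dvd_mult_nat by blast
  thus ?thesis
  proof cases
    case 1
    then obtain u' where u: "u = q * u'" by blast
    have "u' * v = s\<^sup>2" using assms(2) u q0 by simp
    moreover have "coprime u' v" "u' > 0" using assms u by auto
    ultimately show ?thesis using coprime_mult_squareD[of u' v s] assms that u by metis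
  next
    case 2
    then obtain v' where v: "v = q * v'" by blast
    have "u * v' = s\<^sup>2" using assms(2) v q0 by simp
    moreover have "coprime u v'" "v' > 0" using assms v by auto
    ultimately show ?thesis using coprime_mult_squareD[of u v' s] assms that v by metis
  qed
qed

section \<open>Primitive Pythagorean triangles and Fermat's descent\<close>

text \<open>This is the classical form \<open>m\<^sup>2 - n\<^sup>2\<close>,
  \<open>2 * m * n\<close>, \<open>m\<^sup>2 + n\<^sup>2\<close> with \<open>m = n + e\<close>,
  which avoids subtraction on naturals. It follows from
  \<open>v\<^sup>2 = (a + u) * (a - u)\<close>, where half of each factor is a square.\<close>

lemma pythagorean_parametrization:
  fixes u v a :: nat
  assumes uv: "u\<^sup>2 + v\<^sup>2 = a\<^sup>2" and cop: "coprime u v" and "even v" "u > 0" "v > 0"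
  obtains n e where "n > 0" "e > 0" "coprime n e" "odd e"
    "u = e * (2 * n + e)" "v = 2 * n * (n + e)" "a = n\<^sup>2 + (n + e)\<^sup>2"
proof -
  have odd_u: "odd u" using cop \<open>even v\<close> by (auto simp: coprime_def)
  have odd_a: "odd a" using uv odd_u \<open>even v\<close> by (metis even_add even_power)
  have "u\<^sup>2 < a\<^sup>2" using uv \<open>v > 0\<close> by (metis less_add_same_cancel1 zero_less_power)
  hence "u < a" by (rule power_less_imp_less_base) simp
  then obtain r where r: "a = u + 2 * r" "r > 0"
    using odd_u odd_a by (metis less_imp_add_positive even_add evenE gr0I mult_0_right less_not_refl3)
  obtain t where t: "v = 2 * t" using \<open>even v\<close> by blast
  \<comment> \<open>\<open>r + u\<close> and \<open>r\<close> are the halves of \<open>a + u\<close>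
    and \<open>a - u\<close>.\<close>
  have prod: "(r + u) * r = t\<^sup>2"
    using uv unfolding r t by (simp add: power2_eq_square algebra_simps)
  have "coprime (r + u) r"
  proof (rule ccontr)
    assume "\<not> coprime (r + u) r"
    then obtain l where l: "prime l" "l dvd r + u" "l dvd r"
      using prime_factor_nat[of "gcd (r + u) r"] unfolding coprime_iff_gcd_eq_1 by (meson gcd_nat.boundedE)
    hence "l dvd u" by (simp add: dvd_add_right_iff)
    moreover have "l dvd t\<^sup>2" using l prod by (metis dvd_mult)
    hence "l dvd v" using l t prime_dvd_power[of l t 2] by simp
    ultimately show False using cop l(1) by (metis coprime_common_divisor_nat not_prime_1)
  qed
  then obtain m n where mn: "r + u = m\<^sup>2" "r = n\<^sup>2"
    using coprime_mult_squareD[OF _ prod] r by auto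
  have "n\<^sup>2 < m\<^sup>2" using mn \<open>u > 0\<close> by simp
  hence "n < m" by (rule power_less_imp_less_base) simp
  then obtain e where e: "m = n + e" "e > 0" using less_imp_add_positive by blast
  have u: "u = e * (2 * n + e)" using mn e by (simp add: power2_eq_square algebra_simps)
  have "t\<^sup>2 = (n * m)\<^sup>2" using prod mn by (simp add: power_mult_distrib mult.commute)
  hence "t = n * m" by simp
  hence v: "v = 2 * n * (n + e)" using t e by simp
  show ?thesis
  proof
    show "n > 0" using mn r by (cases n) auto
    show "e > 0" by fact
    show "u = e * (2 * n + e)" "v = 2 * n * (n + e)" by fact+
    show "a = n\<^sup>2 + (n + e)\<^sup>2" using r mn e by simp
    show "odd e" using odd_u u by auto
    show "coprime n e" using cop unfolding u v by (auto simp: coprime_commute)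
  qed
qed

text \<open>
  The triangle with legs \<open>(n + e)\<^sup>2 - n\<^sup>2\<close> and \<open>2 * n * (n + e)\<close> has area
  \<open>n * (n + e) * (e * (2 * n + e))\<close>.
\<close>
lemma triangle_area_not_prime_times_square:
  fixes q n e s :: nat
  assumes q: "q = 1 \<or> prime q \<and> q mod 8 = 3"
    and "n > 0" "e > 0" "coprime n e" "odd e"
    and "n * (n + e) * (e * (2 * n + e)) = q * s\<^sup>2"
  shows False
  using assms(2-)
proof (induction "n + e" arbitrary: n e s rule: less_induct)
  case less
  have q1: "q = 1 \<or> prime q" and q0: "q > 0" and odd_q: "odd q"
    using q by (auto simp: prime_gt_0_nat) presburger
  note n = \<open>n > 0\<close> and e = \<open>e > 0\<close> and cop = \<open>coprime n e\<close> and odd_e = \<open>odd e\<close>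
  \<comment> \<open>Being 3 modulo 4, \<open>q = p\<close> divides no sum of two coprime squares;
    this rules out the cases \<open>on_m\<close> and \<open>on_f\<close> below.\<close>
  have q_sum: False if "q \<noteq> 1" "q dvd x\<^sup>2 + y\<^sup>2" "coprime x y" for x y :: nat
  proof -
    have pq: "prime q" "q mod 8 = 3" using q that(1) by auto
    hence q4: "q mod 4 = 3" by presburger
    have "q dvd x" "q dvd y"
      using prime_3_mod_4_dvd_sum_squares[OF pq(1) q4, of x y] prime_3_mod_4_dvd_sum_squares[OF pq(1) q4, of y x]
        that by (auto simp: add.commute)
    thus False using that by (metis coprime_common_divisor_nat)
  qed
  have cop1: "coprime n (n + e)" "coprime (n + e) e" 
    using cop by (simp_all only: coprime_summand_nat coprime_commute[of "n + e" e])
  have "coprime e (2 * n)"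
    using cop odd_e by (simp add: coprime_commute)
  hence copf: "coprime e (2 * n + e)"
    by (metis coprime_summand_nat(2) coprime_commute)
  have "2 * n + e = n + (n + e)" by simp
  hence cop2: "coprime n (2 * n + e)" and "coprime (n + e) (2 * n + e)"
    using cop1(1) by (simp_all only: coprime_summand_nat)
  hence "coprime (n * (n + e)) (e * (2 * n + e))"
    using cop cop1 cop2 by simp
  then obtain x y where "n * (n + e) = q * x\<^sup>2 \<and> e * (2 * n + e) = y\<^sup>2
      \<or> n * (n + e) = x\<^sup>2 \<and> e * (2 * n + e) = q * y\<^sup>2"
    using coprime_mult_prime_squareD[OF _ less.prems(5) _ _ q1] n e by (metis add_gr_0 nat_0_less_mult_iff)
  \<comment> \<open>The four factors are pairwise coprime, so three are squares and one is
    \<open>q\<close> times a square. Each case is named after the factor carrying \<open>q\<close>,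
    with \<open>m\<close> for \<open>n + e\<close> and \<open>f\<close> for
    \<open>2 * n + e\<close>.\<close>
  then consider
      (on_n) a b c d where "n = q * b\<^sup>2" "n + e = a\<^sup>2" "e = c\<^sup>2" "2 * n + e = d\<^sup>2"
    | (on_m) a b c d where "n = b\<^sup>2" "n + e = q * a\<^sup>2" "e = c\<^sup>2" "2 * n + e = d\<^sup>2"
    | (on_e) a b c d where "n = b\<^sup>2" "n + e = a\<^sup>2" "e = q * c\<^sup>2" "2 * n + e = d\<^sup>2"
    | (on_f) a b c d where "n = b\<^sup>2" "n + e = a\<^sup>2" "e = c\<^sup>2" "2 * n + e = q * d\<^sup>2"
  proof (elim disjE conjE)
    assume 1: "n * (n + e) = q * x\<^sup>2" and 2: "e * (2 * n + e) = y\<^sup>2"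
    obtain c d where "e = c\<^sup>2" "2 * n + e = d\<^sup>2"
      using coprime_mult_squareD[OF copf 2] e by auto
    thus ?thesis
      using coprime_mult_prime_squareD[OF cop1(1) 1 _ _ q1] n that(1,2) by (metis add_gr_0)
  next
    assume 1: "n * (n + e) = x\<^sup>2" and 2: "e * (2 * n + e) = q * y\<^sup>2"
    obtain a b where "n = b\<^sup>2" "n + e = a\<^sup>2"
      using coprime_mult_squareD[OF cop1(1) 1] n by auto
    thus ?thesis
      using coprime_mult_prime_squareD[OF copf 2 _ _ q1] e that(3,4) by (metis add_gr_0)
  qed
  \<comment> \<open>For \<open>q = 1\<close> the four cases coincide; for \<open>q = p\<close> all
    but the first are contradictory.\<close>
  hence "\<exists>a b c d. n = q * b\<^sup>2 \<and> n + e = a\<^sup>2 \<and> e = c\<^sup>2 \<and> 2 * n + e = d\<^sup>2"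
  proof cases
    case on_n
    thus ?thesis by blast
  next
    case (on_m a b c d)
    show ?thesis
    proof (cases "q = 1")
      case False
      have "b\<^sup>2 + c\<^sup>2 = q * a\<^sup>2" using on_m by simp
      moreover have "coprime b c" using cop on_m by simp
      ultimately show ?thesis using q_sum[OF False, of b c] by simp
    qed (use on_m in auto)
  next
    case (on_f a b c d)
    show ?thesis
    proof (cases "q = 1")
      case False
      have "a\<^sup>2 + b\<^sup>2 = q * d\<^sup>2" using on_f by simp
      moreover have "coprime a b" using cop1(1) on_f by (simp add: coprime_commute)
      ultimately show ?thesis using q_sum[OF False, of a b] by simp
    qed (use on_f in auto)
  next
    \<comment> \<open>Here the residue of \<open>p\<close> modulo 8 matters:
      \<open>e \<equiv> 3\<close> and \<open>d\<^sup>2 \<equiv> 1\<close> modulo 8 force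
      \<open>n \<equiv> 3\<close> modulo 4, but \<open>n\<close> is a square.\<close>
    case (on_e a b c d)
    show ?thesis
    proof (cases "q = 1")
      case False
      have sq: "x\<^sup>2 mod 8 = 1" if "odd x" for x :: nat
      proof -
        have "x mod 8 \<in> {1, 3, 5, 7}" using that by simp presburger
        hence "(x mod 8)\<^sup>2 mod 8 = 1" by auto
        thus ?thesis by (simp add: power_mod)
      qed
      have "c\<^sup>2 mod 8 = 1" using sq odd_e on_e by simp
      hence e3: "e mod 8 = 3" 
        using q False on_e(3) mod_mult_eq[of q 8 "c\<^sup>2"] by simp
      have "odd (d\<^sup>2)" using odd_e unfolding on_e(4)[symmetric] by simp
      hence "(2 * n + e) mod 8 = 1" unfolding on_e(4) using sq by simp
      hence "n mod 4 = 3" using e3 by presburger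
      moreover have "b\<^sup>2 mod 4 \<noteq> 3"
      proof -
        have "b mod 4 \<in> {0, 1, 2, 3}" by simp presburger
        hence "(b mod 4)\<^sup>2 mod 4 \<noteq> 3" by auto
        thus ?thesis by (simp add: power_mod)
      qed
      ultimately show ?thesis using on_e by simp
    qed (use on_e in auto)
  qed
  then obtain a b c d where sol: "n = q * b\<^sup>2" "n + e = a\<^sup>2" "e = c\<^sup>2" "2 * n + e = d\<^sup>2"
    by blast
  have odd_c: "odd c" using odd_e sol by simp
  have "odd (d\<^sup>2)" using odd_e unfolding sol(4)[symmetric] by simp
  hence odd_d: "odd d" by simp
  have "c\<^sup>2 < d\<^sup>2" using sol(3,4) n by linarith
  hence "c < d" by (rule power_less_imp_less_base) simp
  then obtain v where v: "d = c + 2 * v" "v > 0"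
    using odd_c odd_d by (metis less_imp_add_positive even_add evenE gr0I mult_0_right less_not_refl3)
  \<comment> \<open>So \<open>u = (c + d) / 2\<close> and \<open>v = (d - c) / 2\<close>: these are
    the legs of a new triangle with hypotenuse \<open>a\<close> and area
    \<open>q * t\<^sup>2\<close>, where \<open>b = 2 * t\<close>.\<close>
  define u where "u = c + v"
  have u0: "u > 0" using v u_def by simp
  have "c\<^sup>2 + d\<^sup>2 = 2 * a\<^sup>2" using sol by simp
  hence uva: "u\<^sup>2 + v\<^sup>2 = a\<^sup>2" unfolding v u_def by (simp add: power2_eq_square algebra_simps)
  have "d\<^sup>2 = c\<^sup>2 + 2 * (q * b\<^sup>2)" using sol by simp
  hence uvb: "2 * (u * v) = q * b\<^sup>2" unfolding v u_def by (simp add: power2_eq_square algebra_simps)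
  hence "even (q * b\<^sup>2)" by (metis dvd_triv_left)
  hence "even b" using odd_q by simp
  then obtain t where "b = 2 * t" by blast
  hence uvt: "u * v = 2 * (q * t\<^sup>2)" using uvb by (simp add: power_mult_distrib)
  have "coprime c d" using copf sol by simp
  hence copuv: "coprime u v"
  proof (rule contrapos_pp)
    assume "\<not> coprime u v"
    then obtain l where l: "l dvd u" "l dvd v" "\<not> is_unit l" by (auto simp: coprime_def)
    have "l dvd c" using l unfolding u_def by (simp add: dvd_add_left_iff)
    moreover have "l dvd d" using l \<open>l dvd c\<close> v by simp
    ultimately show "\<not> coprime c d" using l by (auto simp: coprime_def)
  qed
  \<comment> \<open>Stated for arbitrary legs because the parametrization wants the even leg second.
    The measure drops since
    \<open>n' + e' \<le> (n' + e')\<^sup>2 < a \<le> a\<^sup>2 = n + e\<close>.\<close>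
  have descend: False if "u'\<^sup>2 + v'\<^sup>2 = a\<^sup>2" "coprime u' v'" "even v'" "u' > 0" "v' > 0"
      "u' * v' = 2 * (q * t\<^sup>2)" for u' v'
    using that(1-5)
  proof (rule pythagorean_parametrization)
    fix n' e' assume *: "n' > 0" "e' > 0" "coprime n' e'" "odd e'"
      "u' = e' * (2 * n' + e')" "v' = 2 * n' * (n' + e')" "a = n'\<^sup>2 + (n' + e')\<^sup>2"
    have "n' + e' \<le> (n' + e')\<^sup>2" by (simp add: power2_eq_square)
    also have "\<dots> < a" using * by simp
    also have "a \<le> n + e" using sol by (simp add: power2_eq_square)
    finally have "n' + e' < n + e" .
    moreover have "n' * (n' + e') * (e' * (2 * n' + e')) = q * t\<^sup>2"
      using that(6) * by (simp add: algebra_simps)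
    ultimately show False using less.hyps * by blast
  qed
  have "odd (u + v)" using odd_d v u_def by simp
  then consider "even v" | "even u" by auto
  thus False
  proof cases
    case 1
    show False using descend[OF uva copuv 1 u0 v(2) uvt] .
  next
    case 2
    show False using descend[of v u] 2 uva copuv u0 v(2) uvt
      by (simp add: add.commute mult.commute coprime_commute)
  qed
qed

section \<open>Differences of fourth powers\<close>

text \<open>The product of \<open>x\<^sup>2\<close>, \<open>z\<^sup>2\<close>,
  \<open>z\<^sup>2 - x\<^sup>2\<close> and \<open>z\<^sup>2 + x\<^sup>2\<close> is
  \<open>q * (x * z * w)\<^sup>2\<close>. If \<open>e = z\<^sup>2 - x\<^sup>2\<close> is odd, the
  numbers \<open>x\<^sup>2\<close> and \<open>z\<^sup>2\<close> generate a forbidden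
  triangle.\<close>

lemma fourth_powers_difference:
  fixes q x z w :: nat
  assumes q: "q = 1 \<or> prime q \<and> q mod 8 = 3"
    and "coprime x z" "x > 0" "w > 0" and eq: "x ^ 4 + q * w\<^sup>2 = z ^ 4"
  shows False
proof -
  have q0: "q > 0" and odd_q: "odd q" using q by (auto simp: prime_gt_0_nat) presburger
  have "x ^ 4 < z ^ 4" using eq q0 \<open>w > 0\<close> by (metis less_add_same_cancel1 nat_0_less_mult_iff zero_less_power)
  hence "x < z" by (rule power_less_imp_less_base) simp
  hence "x\<^sup>2 < z\<^sup>2" by (simp add: power_strict_mono)
  then obtain e where e: "z\<^sup>2 = x\<^sup>2 + e" "e > 0" using less_imp_add_positive by metis
  have "coprime (x\<^sup>2) (z\<^sup>2)" using \<open>coprime x z\<close> by simp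
  hence cop: "coprime (x\<^sup>2) e" unfolding e(1) coprime_summand_nat .
  have "(z\<^sup>2)\<^sup>2 = (x\<^sup>2)\<^sup>2 + q * w\<^sup>2" using eq by simp
  hence eqe: "e * (2 * x\<^sup>2 + e) = q * w\<^sup>2" unfolding e by (simp add: power2_eq_square algebra_simps)
  show False
  proof (cases "odd e")
    case True
    have "x\<^sup>2 * (x\<^sup>2 + e) * (e * (2 * x\<^sup>2 + e)) = q * (x * z * w)\<^sup>2"
      unfolding eqe e(1)[symmetric] by (simp add: power_mult_distrib)
    thus False
      using triangle_area_not_prime_times_square[OF q, of "x\<^sup>2" e "x * z * w"] True cop e \<open>x > 0\<close>
      by simp
  next
    case False
    \<comment> \<open>When \<open>x\<close> and \<open>z\<close> are both odd, the generators are
      instead \<open>(z\<^sup>2 - x\<^sup>2) / 2\<close> and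
      \<open>(z\<^sup>2 + x\<^sup>2) / 2\<close>, with difference \<open>x\<^sup>2\<close> and sum
      \<open>z\<^sup>2\<close>.\<close>
    then obtain n where n: "e = 2 * n" by blast
    have "odd (x\<^sup>2)" using cop n coprime_common_divisor_nat[of "x\<^sup>2" e 2] by auto
    moreover have "even (q * w\<^sup>2)" using eqe n by (metis dvd_mult2 dvd_triv_left)
    hence "even w" using odd_q by simp
    then obtain t where t: "w = 2 * t" by blast
    have "n * (n + x\<^sup>2) = q * t\<^sup>2"
      using eqe unfolding n t by (simp add: power2_eq_square algebra_simps)
    moreover have "2 * n + x\<^sup>2 = z\<^sup>2" using e n by simp
    ultimately have "n * (n + x\<^sup>2) * (x\<^sup>2 * (2 * n + x\<^sup>2)) = q * (x * z * t)\<^sup>2"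
      by (simp add: power_mult_distrib)
    thus False
      using triangle_area_not_prime_times_square[OF q, of n "x\<^sup>2" "x * z * t"] cop e n \<open>x > 0\<close> \<open>odd (x\<^sup>2)\<close>
      by (simp add: coprime_commute)
  qed
qed

section \<open>Reduction of the original equation to a difference of fourth powers\<close>

lemma square_times_prime_power:
  fixes a p j y :: nat
  assumes "a * p ^ j = y\<^sup>2" "prime p"
  obtains q w where "q = 1 \<or> q = p" "a = q * w\<^sup>2"
proof -
  have p0: "p > 0" using assms by (simp add: prime_gt_0_nat)
  have divide: "\<exists>w. r = w\<^sup>2" if "r * (p ^ i)\<^sup>2 = y\<^sup>2" for r i
  proof -
    have "(p ^ i)\<^sup>2 dvd y\<^sup>2" using that by (metis dvd_triv_right)
    hence "p ^ i dvd y" by simp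
    then obtain w where "y = p ^ i * w" by blast
    hence "r = w\<^sup>2" using that p0 by (simp add: power_mult_distrib)
    thus ?thesis by blast
  qed
  show ?thesis
  proof (cases "even j")
    case True
    then obtain i where "j = 2 * i" by blast
    hence "a * (p ^ i)\<^sup>2 = y\<^sup>2" using assms by (simp add: power_mult mult.commute[of 2])
    then obtain w where "a = w\<^sup>2" using divide by blast
    thus ?thesis using that[of 1 w] by simp
  next
    case False
    then obtain i where "j = 2 * i + 1" using oddE by blast
    hence "(a * p) * (p ^ i)\<^sup>2 = y\<^sup>2" using assms by (simp add: power_mult mult.commute[of 2] ac_simps)
    then obtain w where w: "a * p = w\<^sup>2" using divide by blast
    hence "p dvd w" using assms(2) by (metis dvd_triv_right prime_dvd_power)
    then obtain w' where "w = p * w'" by blast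
    hence "a = p * w'\<^sup>2" using w p0 by (simp add: power2_eq_square)
    thus ?thesis using that[of p w'] by simp
  qed
qed

text \<open>The prime \<open>p\<close> divides at most one of the pairwise coprime \<open>a\<close>,
  \<open>b\<close>, \<open>c\<close>. Attaching \<open>p ^ j\<close> to a suitable one of them makes
  all three fourth powers.\<close>

lemma coprime_sum_product_fourth_power:
  fixes p a b c j D :: nat
  assumes p: "prime p" "p mod 8 = 3"
    and "a > 0" "b > 0" "coprime a b" "a + b = c" "a * b * c * p ^ j = D ^ 4"
  shows False
proof -
  have p0: "p > 0" using p by (simp add: prime_gt_0_nat)
  have cops: "coprime a c" "coprime b c"
    using \<open>coprime a b\<close> \<open>a + b = c\<close> coprime_summand_nat by auto
  have c0: "c > 0" using assms by simp
  have split4: "is_nth_power 4 r \<and> is_nth_power 4 s"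
    if "coprime r s" "r * s = D ^ 4" "r > 0" "s > 0" for r s
    using is_nth_power_mult_coprime_natD[of r s 4] is_nth_power_mult_coprime_natD[of s r 4] that
    by (metis is_nth_power_nth_power)
  have coppow: "coprime r (p ^ j)" if "\<not> p dvd r" for r
    using that p(1) by (metis coprime_commute coprime_power_right_iff prime_imp_coprime)
  \<comment> \<open>Otherwise \<open>a\<close> and \<open>b\<close> are fourth powers, and
    \<open>p\<close> divides a sum of two squares without dividing both.\<close>
  have ndvd_c: "\<not> p dvd c"
  proof
    assume pc: "p dvd c"
    have na: "\<not> p dvd a" "\<not> p dvd b"
      using pc cops p(1) by (metis coprime_common_divisor_nat not_prime_1)+
    have "coprime a (b * (c * p ^ j))" "coprime b (a * (c * p ^ j))"
      using cops \<open>coprime a b\<close> coppow na by (auto simp: coprime_commute)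
    then obtain x y where xy: "a = x ^ 4" "b = y ^ 4"
      using split4[of a "b * (c * p ^ j)"] split4[of b "a * (c * p ^ j)"] assms c0 p0
      by (auto simp: ac_simps elim!: is_nth_powerE)
    have "p dvd (x\<^sup>2)\<^sup>2 + (y\<^sup>2)\<^sup>2" using pc assms xy by simp
    moreover have "p mod 4 = 3" using p by presburger
    ultimately have "p dvd x\<^sup>2" using prime_3_mod_4_dvd_sum_squares p by blast
    hence "p dvd x" using p prime_dvd_power by blast
    hence "p dvd a" using xy dvd_trans[OF _ dvd_power[of 4 x]] by simp
    with na show False by simp
  qed
  \<comment> \<open>\<open>r\<close> is the summand that absorbs \<open>p ^ j\<close>, so
    \<open>a\<close> and \<open>b\<close> may take either role. From \<open>r * p ^ j\<close> being
    a fourth power only its being a square is kept.\<close>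
  have main: False if "r > 0" "s > 0" "coprime r s" "r + s = c" "r * s * c * p ^ j = D ^ 4"
      "\<not> p dvd s" for r s
  proof -
    have copc: "coprime r c" "coprime s c"
      using that(3,4) coprime_summand_nat by auto
    have "coprime s (r * (c * p ^ j))" "coprime c (r * (s * p ^ j))" "coprime (r * p ^ j) (s * c)"
      using copc that coppow[of s] coppow[of c] ndvd_c by (auto simp: coprime_commute)
    hence "is_nth_power 4 s" "is_nth_power 4 c" "is_nth_power 4 (r * p ^ j)"
      using split4[of s "r * (c * p ^ j)"] split4[of c "r * (s * p ^ j)"]
        split4[of "r * p ^ j" "s * c"] that c0 p0
      by (auto simp: ac_simps)
    then obtain x z y where xyz: "s = x ^ 4" "c = z ^ 4" "r * p ^ j = y ^ 4"
      by (auto elim!: is_nth_powerE)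
    have "r * p ^ j = (y\<^sup>2)\<^sup>2" using xyz by simp
    then obtain q w where q: "q = 1 \<or> q = p" and w: "r = q * w\<^sup>2"
      using p(1) by (rule square_times_prime_power)
    have "coprime x z" using copc(2) xyz by simp
    moreover have "x > 0" using xyz that(2) by (cases x) auto
    moreover have "w > 0" using w that(1) by (cases w) auto
    moreover have "x ^ 4 + q * w\<^sup>2 = z ^ 4" using that w xyz by simp
    moreover have "q = 1 \<or> prime q \<and> q mod 8 = 3" using q p by auto
    ultimately show False using fourth_powers_difference by blast
  qed
  have "\<not> p dvd a \<or> \<not> p dvd b"
    using \<open>coprime a b\<close> p(1) by (metis coprime_common_divisor_nat not_prime_1)
  thus False
    using main[of a b] main[of b a] assms by (auto simp: ac_simps coprime_commute)
qed

theorem theorem3: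
  fixes p k :: nat
  assumes "prime p" and "odd p" and "[p = 3] (mod 8)" and "k > 0"
  shows "\<not> (\<exists>A B C D :: nat. A > 0 \<and> B > 0 \<and> C > 0 \<and> D > 0 \<and>
           Gcd {A, B, C} = p ^ k \<and> A + B = C \<and> A * B * C = D ^ 4)"
proof (intro notI, elim exE conjE)
  fix A B C D :: nat
  assume pos: "A > 0" "B > 0" and gcd: "Gcd {A, B, C} = p ^ k"
    and sum: "A + B = C" and prod: "A * B * C = D ^ 4"
  \<comment> \<open>As \<open>A + B = C\<close>, the triple gcd equals \<open>gcd A B\<close>, so
    the cofactors of \<open>A\<close> and \<open>B\<close> are coprime.\<close>
  have "gcd A B dvd C" using sum by auto
  hence gcdAB: "gcd A B = p ^ k"
    using gcd by (simp add: gcd.assoc[symmetric] gcd_proj1_iff)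
  then obtain a b where ab: "A = a * p ^ k" "B = b * p ^ k" "coprime a b"
    using gcd_coprime_exists[of A B] pos gcdAB by (metis gcd_eq_0_iff less_numeral_extra(3))
  \<comment> \<open>Each of \<open>A\<close>, \<open>B\<close>, \<open>C\<close> contributes one
    factor \<open>p ^ k\<close>.\<close>
  have "a * b * (a + b) * p ^ (3 * k) = D ^ 4"
    using prod unfolding sum[symmetric] ab
    by (simp add: numeral_3_eq_3 algebra_simps power_add)
  moreover have "p mod 8 = 3" using assms(3) by (simp add: cong_def)
  moreover have "a > 0" "b > 0" using ab pos by auto
  ultimately show False
    using coprime_sum_product_fourth_power assms(1) ab(3) by blast
qed

end
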